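(* Let $1<k\in\mathbb{Z}$ and $n=2k+1$. Let $\alpha(v^0)=a_{k-1}\cdots a_1=00\cdots 0$. To each $\delta(v)$ (with $v\in L_k/\pi$) corresponds a sole $k$-germ $\alpha=\alpha(v)$ with $\langle F(\alpha)\rangle=\delta(v)$ by means of the following "Uncastling Procedure". Given $v\in L_k/\pi$, let $W^i=01\cdots i$ be the maximal initial numeric (i.e., colored) substring of $\delta(v)$, so the length of $W^i$ is $i+1$ ($0\le i\le k$). If $i=k$, let $\alpha(v)=\alpha(v^0)$; else, set $m=0$ and: 1. set $\delta(v^m)=\langle W^i|X|Y|Z^i\rangle$, where $Z^i$ is the terminal $j_m$-substring of $\delta(v^m)$ (i.e. its terminal substring of length $j_m$), with $j_m=i+1$, and let $X,Y$ (in that order) start at contiguous numbers $\Omega$ and $\Omega-1\ge i$; 2. set $\delta(v^{m+1})=\langle W^i|Y|X|Z^i\rangle$; 3. obtain $\alpha(v^{m+1})$ from $\alpha(v^m)$ by increasing its entry $a_{j_m}$ by $1$; 4. if $\delta(v^{m+1})=\langle 01\cdots k*\cdots*\rangle$, then stop; else, increase $m$ by $1$ and go to step 1.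
   Context: $k$-germs and $F$. A $k$-germ is a $(k-1)$-string $\alpha=a_{k-1}\cdots a_1$ of nonnegative integers with $a_{k-1}\in\{0,1\}$ and $0\le a_{i-1}\le a_i+1$ for $1<i<k$. For $\alpha\ne0^{k-1}$ with rightmost nonzero entry $a_i$, $\beta(\alpha)$ is the $k$-germ obtained from $\alpha$ by replacing $a_i$ by $a_i-1$. The $n$-string $F(\alpha)$, with entries $0,1,\ldots,k$ (once each) and $k$ asterisks, is defined recursively: $F(0^{k-1})=01\cdots k*\cdots*$; and if $\alpha\ne 0^{k-1}$ has rightmost nonzero entry $a_i$, write $F(\beta(\alpha))=W|X|Y|Z$ with $W,Z$ its initial and terminal substrings of length $i$, $\Omega$ the first entry of $X$, and $Y$ starting at the entry $\Omega+1$; then $F(\alpha)=W|Y|X|Z$ ("Castling"). The bar $|$ denotes concatenation. $\delta(v)$. $L_k$ is the set of binary $n$-strings of weight $k$ (coordinates indexed by $\mathbb{Z}_n$), and $L_k/\pi$ is the set of its classes under cyclic translation of coordinates. For $b=b_0\cdots b_{n-1}\in L_k$ put $S=\{i: b_i=1\}$ and $S^c=\mathbb{Z}_n\setminus S$; for $x,y\in\mathbb{Z}_n$ put $[y,x)=\{y,y+1,\ldots,x-1\}$ (mod $n$). Each position $x\in S^c$ receives the lexical color $|\{y\in S^c\setminus\{x\}: |[y,x)\cap S|<|[y,x)\cap S^c|\}|$; the $k+1$ positions of $S^c$ receive the colors $0,1,\ldots,k$, once each. Labelling every $0$-entry of $b$ by its color and every $1$-entry by $*$ gives an $n$-string of labels,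 which up to translation depends only on the class $v$ of $b$. $\delta(v)$ is this string of labels, written starting at the label $0$, and $\langle\cdot\rangle$ denotes the class of an $n$-string of labels (written starting at the entry $0$). It serves as a notation for the pair $\{v,\aleph_\pi(v)\}$, where $\aleph_\pi$ sends the class of $b_0b_1\cdots b_{n-1}$ to the class of its complemented reversal $\bar b_{n-1}\cdots\bar b_1\bar b_0$ ($\bar 0=1$, $\bar 1=0$); these pairs are the vertices of the quotient of the middle-levels graph (the graph induced in the $n$-cube by the strings of weight $k$ and $k+1$) by the dihedral group generated by translations and complemented reversal. In the procedure, $v^0=v$ and the final $k$-germ obtained is $\alpha(v)$. *)

theory Defs
  imports Main "HOL-Library.Sublist"
begin

text \<open>
  A string \<open>a\<^sub>k\<^sub>-\<^sub>1 \<dots> a\<^sub>1\<close> is the list \<open>[a\<^sub>k\<^sub>-\<^sub>1, \<dots>, a\<^sub>1]\<close>. Its entries are numbered from the right,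
  starting at 1, so \<open>entry \<alpha> i\<close> is \<open>a\<^sub>i\<close> for \<open>1 \<le> i \<le> length \<alpha>\<close>.
\<close>

definition entry :: "nat list \<Rightarrow> nat \<Rightarrow> nat" where
  "entry \<alpha> i = \<alpha> ! (length \<alpha> - i)"

definition set_entry :: "nat list \<Rightarrow> nat \<Rightarrow> nat \<Rightarrow> nat list" where
  "set_entry \<alpha> i x = \<alpha>[length \<alpha> - i := x]"

definition is_germ :: "nat \<Rightarrow> nat list \<Rightarrow> bool" where
  "is_germ k \<alpha> \<longleftrightarrow> length \<alpha> = k - 1 \<and> entry \<alpha> (k - 1) \<in> {0, 1} \<and>
     (\<forall>i. 1 < i \<and> i < k \<longrightarrow> entry \<alpha> (i - 1) \<le> entry \<alpha> i + 1)"

definition rightmost_nonzero :: "nat list \<Rightarrow> nat" where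
  "rightmost_nonzero \<alpha> = (LEAST i. 1 \<le> i \<and> i \<le> length \<alpha> \<and> entry \<alpha> i \<noteq> 0)"

definition germ_parent :: "nat list \<Rightarrow> nat list" where
  "germ_parent \<alpha> = (let i = rightmost_nonzero \<alpha> in set_entry \<alpha> i (entry \<alpha> i - 1))"

lemma sum_list_germ_parent:
  assumes "\<exists>a\<in>set \<alpha>. a \<noteq> 0"
  shows "sum_list (germ_parent \<alpha>) < sum_list \<alpha>"
proof -
  let ?P = "\<lambda>i. 1 \<le> i \<and> i \<le> length \<alpha> \<and> entry \<alpha> i \<noteq> 0"
  from assms obtain p where p: "p < length \<alpha>" "\<alpha> ! p \<noteq> 0"
    by (auto simp: in_set_conv_nth)
  then have "?P (length \<alpha> - p)" by (auto simp: entry_def)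
  then have i: "?P (rightmost_nonzero \<alpha>)"
    unfolding rightmost_nonzero_def by (rule LeastI)
  define q where "q = length \<alpha> - rightmost_nonzero \<alpha>"
  have q: "q < length \<alpha>" "0 < \<alpha> ! q" using i by (auto simp: q_def entry_def)
  have "\<alpha> ! q \<le> sum_list \<alpha>" using q(1) by (simp add: elem_le_sum_list)
  then have "sum_list (\<alpha>[q := \<alpha> ! q - 1]) < sum_list \<alpha>"
    using q by (simp add: sum_list_update)
  then show ?thesis
    by (simp add: germ_parent_def set_entry_def Let_def entry_def q_def)
qed

datatype label = Num nat | Ast

definition initial_string :: "nat \<Rightarrow> label list" where
  "initial_string k = map Num [0..<k + 1] @ replicate k Ast"

definition castling :: "nat \<Rightarrow> label list \<Rightarrow> label list \<Rightarrow> bool" where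
  "castling i s t \<longleftrightarrow> (\<exists>W X Y Z \<Omega> X' Y'.
     s = W @ X @ Y @ Z \<and> length W = i \<and> length Z = i \<and>
     X = Num \<Omega> # X' \<and> Y = Num (\<Omega> + 1) # Y' \<and>
     t = W @ Y @ X @ Z)"

function F :: "nat list \<Rightarrow> label list" where
  "F \<alpha> = (if \<forall>a\<in>set \<alpha>. a = 0 then initial_string (length \<alpha> + 1)
          else THE t. castling (rightmost_nonzero \<alpha>) (F (germ_parent \<alpha>)) t)"
  by pat_completeness auto
termination
  by (relation "measure sum_list") (auto intro: sum_list_germ_parent)

declare F.simps [simp del]

text \<open>The class \<open>\<langle>s\<rangle>\<close> of a string of labels is given by its translate that starts at the label 0.\<close>

definition from_zero :: "label list \<Rightarrow> label list" where
  "from_zero s = dropWhile (\<lambda>l. l \<noteq> Num 0) s @ takeWhile (\<lambda>l. l \<noteq> Num 0) s"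

definition L :: "nat \<Rightarrow> bool list set" where
  "L k = {b. length b = 2 * k + 1 \<and> length (filter id b) = k}"

definition translates :: "bool list \<Rightarrow> bool list set" where
  "translates b = {rotate m b | m. True}"

definition L_mod_pi :: "nat \<Rightarrow> bool list set set" where
  "L_mod_pi k = translates ` L k"

definition cyclic_interval :: "nat \<Rightarrow> nat \<Rightarrow> nat \<Rightarrow> nat set" where
  "cyclic_interval n y x = {(y + j) mod n | j. j < (x + n - y) mod n}"

definition lexical_color :: "bool list \<Rightarrow> nat \<Rightarrow> nat" where
  "lexical_color b x =
     (let n = length b; S = {i. i < n \<and> b ! i}; Sc = {i. i < n \<and> \<not> b ! i}
      in card {y \<in> Sc - {x}.
           card (cyclic_interval n y x \<inter> S) < card (cyclic_interval n y x \<inter> Sc)})"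

definition labelling :: "bool list \<Rightarrow> label list" where
  "labelling b = map (\<lambda>x. if b ! x then Ast else Num (lexical_color b x)) [0..<length b]"

text \<open>All members of a class have the same labelling up to translation, so the image below is a
  singleton.\<close>

definition delta :: "bool list set \<Rightarrow> label list" where
  "delta v = the_elem ((\<lambda>b. from_zero (labelling b)) ` v)"

text \<open>
  The index \<open>i\<close> of the longest initial substring of the form \<open>W\<^sup>i = 01\<dots>i\<close>. The next label may still
  be a number, just not \<open>i + 1\<close>: for \<open>02*1*\<close> the index is 0.
\<close>

definition W_index :: "label list \<Rightarrow> nat" where
  "W_index s = (GREATEST i. prefix (map Num [0..<i + 1]) s)"

text \<open>
  Steps 1 to 3, on pairs of a class \<open>v\<^sup>m\<close> and a string \<open>\<alpha>(v\<^sup>m)\<close>. The index \<open>i\<close> is determined anew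
  from the current \<open>\<delta>(v\<^sup>m)\<close>, and the second of the two contiguous numbers, \<open>\<Omega> - 1\<close>, is \<open>\<omega>\<close> here. The
  step is only possible if the new string is \<open>\<delta>\<close> of a class and the entry to be increased exists.
\<close>

definition uncastling_step ::
  "nat \<Rightarrow> bool list set \<times> nat list \<Rightarrow> bool list set \<times> nat list \<Rightarrow> bool" where
  "uncastling_step k = (\<lambda>(v, \<alpha>) (v', \<alpha>').
     \<exists>i j W X Y Z \<omega> X' Y'.
       i = W_index (delta v) \<and> j = i + 1 \<and>
       delta v = W @ X @ Y @ Z \<and> W = map Num [0..<i + 1] \<and> length Z = j \<and>
       X = Num (\<omega> + 1) # X' \<and> Y = Num \<omega> # Y' \<and> i \<le> \<omega> \<and>
       v' \<in> L_mod_pi k \<and> delta v' = from_zero (W @ Y @ X @ Z) \<and>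
       j \<le> length \<alpha> \<and> \<alpha>' = set_entry \<alpha> j (entry \<alpha> j + 1))"

text \<open>
  A run is the list of the pairs \<open>(v\<^sup>0, \<alpha>(v\<^sup>0)), \<dots>, (v\<^sup>m, \<alpha>(v\<^sup>m))\<close> computed so far. Before any step the
  procedure ends if \<open>i = k\<close>; afterwards it ends by step 4.
\<close>

definition stopped :: "nat \<Rightarrow> (bool list set \<times> nat list) list \<Rightarrow> bool" where
  "stopped k r \<longleftrightarrow>
     (if length r = 1 then W_index (delta (fst (last r))) = k
      else delta (fst (last r)) = from_zero (initial_string k))"

inductive uncastling_run ::
  "nat \<Rightarrow> bool list set \<Rightarrow> (bool list set \<times> nat list) list \<Rightarrow> bool"
  for k v where
  start: "uncastling_run k v [(v, replicate (k - 1) 0)]"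
| step: "uncastling_run k v r \<Longrightarrow> \<not> stopped k r \<Longrightarrow> uncastling_step k (last r) p \<Longrightarrow>
    uncastling_run k v (r @ [p])"

text \<open>
  The procedure, started at \<open>v\<close>, terminates with output \<open>\<alpha>\<close>. As every run is an initial part of the
  one that stops, there is never a choice, no run gets stuck and none continues forever.
\<close>

definition uncastling_yields :: "nat \<Rightarrow> bool list set \<Rightarrow> nat list \<Rightarrow> bool" where
  "uncastling_yields k v \<alpha> \<longleftrightarrow>
     (\<exists>r. uncastling_run k v r \<and> stopped k r \<and> snd (last r) = \<alpha> \<and>
          (\<forall>r'. uncastling_run k v r' \<longrightarrow> prefix r' r))"

end

theory Submission
  imports Defs
begin

text \<open>
  Read a color as an up-step and an asterisk as a down-step. Started at the label 0, a class of \<open>L\<^sub>k/\<pi>\<close>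
  becomes an up-step followed by the contour of an ordered forest with \<open>k\<close> nodes, and the contour
  forces the colors: they increase with the height and, within one height, from right to left. If
  \<open>W\<^sup>i\<close> is the maximal initial substring and \<open>i < k\<close>, then above the chain \<open>W\<^sup>i\<close> there are \<open>c \<ge> 2\<close> trees
  \<open>t\<^sub>1, \<dots>, t\<^sub>c\<close>, \<open>X\<close> is the contour of \<open>t\<^sub>1\<close>, and the step makes \<open>t\<^sub>1\<close> the last subtree of the root of \<open>t\<^sub>c\<close>;
  castling is the inverse move. So \<open>a\<^sub>i\<^sub>+\<^sub>1\<close> counts the trees to the left of \<open>t\<^sub>c\<close>. When all of them have
  been moved, they are among the \<open>a\<^sub>i\<^sub>+\<^sub>2 + 1\<close> subtrees of the root of \<open>t\<^sub>c\<close>, which is the germ condition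
  \<open>a\<^sub>i\<^sub>+\<^sub>1 \<le> a\<^sub>i\<^sub>+\<^sub>2 + 1\<close>; hence every forest comes from a germ. As the procedure is deterministic and
  started at \<open>\<langle>F(\<alpha>)\<rangle>\<close> it undoes the castlings that built \<open>F(\<alpha>)\<close>, it returns \<open>\<alpha>\<close>, so \<open>\<alpha>\<close> is unique.
\<close>

section \<open>Heights and lexical labellings\<close>

text \<open>\<open>True\<close> stands for a 1-entry, hence for an asterisk, and so is the
  down-step; words in \<open>L k\<close> therefore have height 1.\<close>

definition ht :: "bool list \<Rightarrow> int" where
  "ht w = (\<Sum>x\<leftarrow>w. if x then - 1 else 1)"

lemma ht_simps [simp]:
  "ht [] = 0" "ht (x # w) = (if x then - 1 else 1) + ht w" "ht (w @ w') = ht w + ht w'"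
  "ht (replicate m True) = - int m" "ht (replicate m False) = int m"
  by (auto simp: ht_def sum_list_replicate)

definition shape :: "label list \<Rightarrow> bool list" where
  "shape s = map (\<lambda>l. l = Ast) s"

lemma shape_simps [simp]:
  "shape [] = []" "shape (l # s) = (l = Ast) # shape s" "shape (s @ t) = shape s @ shape t"
  "length (shape s) = length s"
  by (simp_all add: shape_def)

lemma shape_eq_append:
  assumes "shape s = u @ w"
  obtains s1 s2 where "s = s1 @ s2" "shape s1 = u" "shape s2 = w"
  using assms by (auto simp: shape_def map_eq_append_conv)

lemma shape_eq_FalseE:
  assumes "shape s = False # w"
  obtains a s' where "s = Num a # s'" "shape s' = w"
  using assms by (cases s; cases "hd s") (auto simp: shape_def)

lemma shape_eq_replicate_True: "shape s = replicate m True \<Longrightarrow> s = replicate m Ast"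
  by (induction m arbitrary: s) (auto simp: shape_def)

text \<open>The height recorded for a number is that at the foot of its up-step, so in the chain
  \<open>01...i\<close> started at height 0 every number equals its height.\<close>

primrec levels :: "int \<Rightarrow> label list \<Rightarrow> (int \<times> nat) list" where
  "levels c [] = []"
| "levels c (l # s) = (case l of Num a \<Rightarrow> (c, a) # levels (c + 1) s | Ast \<Rightarrow> levels (c - 1) s)"

primrec nums :: "label list \<Rightarrow> nat list" where
  "nums [] = []"
| "nums (l # s) = (case l of Num a \<Rightarrow> a # nums s | Ast \<Rightarrow> nums s)"

lemma nums_append [simp]: "nums (s @ t) = nums s @ nums t"
  by (induction s) (auto split: label.split)

lemma set_nums: "set (nums s) = {a. Num a \<in> set s}"
  by (induction s) (auto split: label.split)

lemma nums_replicate_Ast [simp]: "nums (replicate m Ast) = []"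
  by (induction m) auto

lemma nums_map_Num [simp]: "nums (map Num xs) = xs"
  by (induction xs) auto

lemma map_snd_levels: "map snd (levels c s) = nums s"
  by (induction s arbitrary: c) (auto split: label.split)

lemma levels_snd_in_nums: "(h, a) \<in> set (levels c s) \<Longrightarrow> a \<in> set (nums s)"
  by (metis image_eqI list.set_map map_snd_levels snd_conv)

lemma nums_in_levels:
  assumes "a \<in> set (nums s)"
  shows "\<exists>h. (h, a) \<in> set (levels c s)"
proof -
  have "a \<in> set (map snd (levels c s))" using assms by (simp only: map_snd_levels)
  then show ?thesis by force
qed

lemma levels_append [simp]: "levels c (s @ t) = levels c s @ levels (c + ht (shape s)) t"
  by (induction s arbitrary: c) (auto split: label.split simp: algebra_simps)

lemma levels_shift: "levels (c + d) s = map (\<lambda>(h, a). (h + d, a)) (levels c s)"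
proof (induction s arbitrary: c)
  case (Cons l s)
  from Cons[of "c + 1"] Cons[of "c - 1"] show ?case
    by (auto split: label.split simp: algebra_simps)
qed simp

lemma levels_replicate_Ast [simp]: "levels c (replicate m Ast) = []"
  by (induction m arbitrary: c) auto

lemma levels_map_Num_upt:
  "levels (int m) (map Num [m..<m + d]) = map (\<lambda>j. (int j, j)) [m..<m + d]"
proof (induction d arbitrary: m)
  case (Suc d)
  have "[m..<m + Suc d] = m # [Suc m..<Suc m + d]" by (simp add: upt_conv_Cons del: upt_Suc)
  with Suc[of "Suc m"] show ?case by (simp add: add.commute del: upt_Suc)
qed simp

definition ranked :: "int \<times> nat \<Rightarrow> int \<times> nat \<Rightarrow> bool" where
  "ranked p q \<longleftrightarrow> (snd p < snd q \<longleftrightarrow> fst p < fst q)"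

text \<open>The lexical colors list the heights in ascending order, and positions of equal height from right
  to left; \<open>ranked\<close> is this condition for two numbers of which the first stands to the left.\<close>

definition lexical :: "nat \<Rightarrow> label list \<Rightarrow> bool" where
  "lexical k s \<longleftrightarrow> distinct (nums s) \<and> set (nums s) = {..k} \<and> sorted_wrt ranked (levels 0 s)"

lemma sorted_wrt_ranked_shift:
  "sorted_wrt ranked (levels c s) \<longleftrightarrow> sorted_wrt ranked (levels 0 s)"
proof -
  have "levels c s = map (\<lambda>(h, a). (h + c, a)) (levels 0 s)"
    using levels_shift[of 0 c s] by simp
  then show ?thesis
    by (simp add: sorted_wrt_map ranked_def[abs_def] case_prod_beta)
qed

lemma lexical_initial_string: "lexical k (initial_string k)"
proof -
  have "levels 0 (map Num [0..<k + 1]) = map (\<lambda>j. (int j, j)) [0..<k + 1]"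
    using levels_map_Num_upt[of 0 "k + 1"] by (simp del: upt_Suc)
  then show ?thesis
    by (auto simp: lexical_def initial_string_def ranked_def sorted_wrt_map sorted_wrt_iff_nth_less
        simp del: upt_Suc map_append)
qed

section \<open>Forests\<close>

datatype tree = Node "tree list"

primrec tree_word :: "tree \<Rightarrow> bool list" where
  "tree_word (Node ts) = False # concat (map tree_word ts) @ [True]"

definition forest_word :: "tree list \<Rightarrow> bool list" where
  "forest_word ts = concat (map tree_word ts)"

lemma forest_word_simps [simp]:
  "forest_word [] = []" "forest_word (t # ts) = tree_word t @ forest_word ts"
  "forest_word (ts @ us) = forest_word ts @ forest_word us"
  by (simp_all add: forest_word_def)

lemma tree_word_Node [simp]: "tree_word (Node ts) = False # forest_word ts @ [True]"
  by (simp add: forest_word_def)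

declare tree_word.simps [simp del]

lemma ht_tree_word [simp]: "ht (tree_word t) = 0"
proof (induction t)
  case (Node ts)
  have "ht (forest_word ts) = 0" using Node by (induction ts) auto
  then show ?case by simp
qed

lemma ht_forest_word [simp]: "ht (forest_word ts) = 0"
  by (induction ts) auto

text \<open>The root's up-step lifts the subtrees by one and only the closing asterisk undoes
  this.\<close>

lemma levels_tree_word_ge:
  "shape s = tree_word t \<Longrightarrow> (h, a) \<in> set (levels c s) \<Longrightarrow> c \<le> h"
proof (induction t arbitrary: s c)
  case (Node ts)
  \<comment> \<open>The inclusion in \<open>ts\<close> keeps the outer induction hypothesis
    applicable to every tree of the inner induction.\<close>
  have forest: "c' \<le> h" if "shape s' = forest_word us" "(h, a) \<in> set (levels c' s')" "set us \<subseteq> set ts"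
    for us s' c'
    using that
  proof (induction us arbitrary: s')
    case (Cons u us)
    from Cons.prems(1) have "shape s' = tree_word u @ forest_word us" by simp
    then obtain s1 s2 where s': "s' = s1 @ s2" "shape s1 = tree_word u" "shape s2 = forest_word us"
      by (rule shape_eq_append)
    with Cons.prems have "(h, a) \<in> set (levels c' s1) \<or> (h, a) \<in> set (levels c' s2)" by simp
    then show ?case using Cons.IH[of s2] Node.IH[of u s1 c'] s' Cons.prems by auto
  qed (auto simp: shape_def)
  from Node.prems(1) have "shape s = False # (forest_word ts @ [True])" by simp
  then obtain b s' where s: "s = Num b # s'" "shape s' = forest_word ts @ [True]"
    by (rule shape_eq_FalseE)
  from s(2) obtain s1 s2 where s': "s' = s1 @ s2" "shape s1 = forest_word ts" "shape s2 = [True]"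
    by (rule shape_eq_append)
  have "s2 = [Ast]" using shape_eq_replicate_True[of s2 1] s'(3) by simp
  then show ?case using Node.prems s s' forest[of s1 ts "c + 1"] by auto
qed

lemma levels_forest_word_ge:
  assumes "shape s = forest_word ts" "(h, a) \<in> set (levels c s)"
  shows "c \<le> h"
  using assms
proof (induction ts arbitrary: s)
  case (Cons u us)
  from Cons.prems(1) have "shape s = tree_word u @ forest_word us" by simp
  then obtain s1 s2 where "s = s1 @ s2" "shape s1 = tree_word u" "shape s2 = forest_word us"
    by (rule shape_eq_append)
  then show ?case using Cons levels_tree_word_ge[of s1 u h a c] by auto
qed (auto simp: shape_def)

text \<open>The root is the only up-step on the lowest level of its tree. In
  \<open>castling_swap\<close> this excludes smaller labels further right in the tree.\<close>

lemma tree_wordE: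
  assumes "shape s = tree_word t"
  obtains b s' where "s = Num b # s'" "\<And>c h a. (h, a) \<in> set (levels c s') \<Longrightarrow> c \<le> h"
proof -
  obtain ts where t: "t = Node ts" by (cases t)
  then have "shape s = False # (forest_word ts @ [True])" using assms by simp
  then obtain b s' where s: "s = Num b # s'" "shape s' = forest_word ts @ [True]"
    by (rule shape_eq_FalseE)
  from s(2) obtain s1 s2 where s': "s' = s1 @ s2" "shape s1 = forest_word ts" "shape s2 = [True]"
    by (rule shape_eq_append)
  have "s2 = [Ast]" using shape_eq_replicate_True[of s2 1] s'(3) by simp
  then have "c \<le> h" if "(h, a) \<in> set (levels c s')" for c h a
    using that s' levels_forest_word_ge[of s1 ts h a c] by auto
  with s(1) that show ?thesis by blast
qed

text \<open>\<open>X\<close> consists of the trees \<open>A\<close>, the opening step of the last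
  root and its subtrees \<open>B\<close>; \<open>Y\<close> is the last subtree of that root. Moving
  \<open>Y\<close> in front of \<open>X\<close> lowers it by one level, and since equal heights are
  ordered from right to left, this compensates for the change of sides: every label may be
  kept.\<close>

lemma castling_swap:
  assumes lex: "lexical k (W @ X @ Y @ replicate i Ast)"
    and W: "W = map Num [0..<i]"
    and X: "shape X = forest_word A @ False # forest_word B"
    and Y: "shape Y = tree_word t"
  obtains \<Omega> X' Y' where "X = Num \<Omega> # X'" "Y = Num (\<Omega> + 1) # Y'" "i \<le> \<Omega>"
    "lexical k (W @ Y @ X @ replicate i Ast)"
proof -
  have htW: "ht (shape W) = int i"
    unfolding W by (simp add: shape_def comp_def map_replicate_const)
  have htX: "ht (shape X) = 1" by (simp add: X)
  have htY: "ht (shape Y) = 0" by (simp add: Y)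
  have "\<exists>w. shape X = False # w"
  proof (cases A)
    case (Cons u us)
    then show ?thesis by (cases u) (simp add: X)
  qed (simp add: X)
  then obtain \<Omega> X' where X': "X = Num \<Omega> # X'" by (meson shape_eq_FalseE)
  obtain y Y' where Y': "Y = Num y # Y'" "\<And>c h a. (h, a) \<in> set (levels c Y') \<Longrightarrow> c \<le> h"
    using tree_wordE[OF Y] by blast
  let ?LW = "levels 0 W" and ?LX = "levels (int i) X" and ?LY = "levels (int i + 1) Y"
  have levW: "?LW = map (\<lambda>j. (int j, j)) [0..<i]"
    unfolding W using levels_map_Num_upt[of 0 i] by simp
  have dist: "distinct (nums W @ nums X @ nums Y)"
    and sets: "set (nums W) \<union> set (nums X) \<union> set (nums Y) = {..k}"
    and sorted: "sorted_wrt ranked (?LW @ ?LX @ ?LY)"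
    using lex by (auto simp: lexical_def htW htX)
  have numsW: "set (nums W) = {..<i}" by (auto simp: W)
  have \<Omega>: "i \<le> \<Omega>" using dist numsW X' by auto
  have y: "\<Omega> < y" using sorted X' Y'(1) by (auto simp: sorted_wrt_append ranked_def)
  have "y \<le> k" using sets Y'(1) by auto
  \<comment> \<open>A label strictly between \<Omega> and y has no room: in \<open>X'\<close> its
    height would have to be above \<open>i\<close> and below \<open>i + 1\<close>; in
    \<open>Y'\<close> every height exceeds that of y, which forces a larger label.\<close>
  have "y = \<Omega> + 1"
  proof (rule ccontr)
    assume "y \<noteq> \<Omega> + 1"
    define c where "c = \<Omega> + 1"
    have c: "\<Omega> < c" "c < y" using \<open>y \<noteq> \<Omega> + 1\<close> y by (auto simp: c_def)
    have "c \<notin> set (nums W)" using c \<Omega> numsW by auto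
    moreover have "c \<in> {..k}" using c \<open>y \<le> k\<close> by simp
    then have "c \<in> set (nums W) \<union> set (nums X) \<union> set (nums Y)" unfolding sets .
    ultimately have "c \<in> set (nums X') \<or> c \<in> set (nums Y')" using X' Y'(1) c by auto
    then show False
    proof
      assume "c \<in> set (nums X')"
      then obtain h where h: "(h, c) \<in> set (levels (int i + 1) X')" using nums_in_levels by blast
      then have "ranked (int i, \<Omega>) (h, c)" "ranked (h, c) (int i + 1, y)"
        using sorted X' Y'(1) by (auto simp: sorted_wrt_append)
      then show False using c by (auto simp: ranked_def)
    next
      assume "c \<in> set (nums Y')"
      then obtain h where h: "(h, c) \<in> set (levels (2 + int i) Y')" using nums_in_levels by blast
      then have "ranked (int i + 1, y) (h, c)"
        using sorted Y'(1) by (auto simp: sorted_wrt_append)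
      then show False using c Y'(2)[OF h] by (auto simp: ranked_def)
    qed
  qed
  moreover have "lexical k (W @ Y @ X @ replicate i Ast)"
  proof -
    have LY: "?LY = map (\<lambda>(h, a). (h + 1, a)) (levels (int i) Y)"
      by (rule levels_shift)
    have WY: "ranked p q" if "p \<in> set ?LW" "q \<in> set (levels (int i) Y)" for p q
    proof -
      obtain h a where q: "q = (h, a)" by (cases q)
      then have "int i \<le> h" using levels_tree_word_ge[OF Y] that(2) by blast
      have "a \<in> set (nums Y)" using that(2) q levels_snd_in_nums by blast
      then have "i \<le> a" using dist numsW by (force simp: disjoint_iff)
      with \<open>int i \<le> h\<close> that(1) q show ?thesis by (auto simp: levW ranked_def)
    qed
    \<comment> \<open>With p on the left, the label of p was smaller iff
      \<open>fst p < h + 1\<close>; with q on the left, the label of q must be smaller iff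
      \<open>h < fst p\<close>. These conditions are complementary, and so are the two orders of
      distinct labels.\<close>
    have YX: "ranked q p" if p: "p \<in> set ?LX" and q: "q \<in> set (levels (int i) Y)" for p q
    proof -
      obtain h a where q': "q = (h, a)" by (cases q)
      then have "(h + 1, a) \<in> set ?LY" using q LY by force
      then have "ranked p (h + 1, a)" using sorted p by (auto simp: sorted_wrt_append)
      moreover have "snd p \<noteq> a"
        using levels_snd_in_nums[of "fst p" "snd p" "int i" X] levels_snd_in_nums[of h a "int i" Y]
          p q q' dist by (auto simp: disjoint_iff)
      ultimately show ?thesis by (auto simp: ranked_def q')
    qed
    have "sorted_wrt ranked (levels 0 W @ levels (int i) Y @ levels (int i) X)"
      using sorted WY YX sorted_wrt_ranked_shift[of "int i + 1" Y] sorted_wrt_ranked_shift[of "int i" Y]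
      by (auto simp: sorted_wrt_append)
    then show ?thesis using dist sets by (auto simp: lexical_def htW htY)
  qed
  ultimately show ?thesis using that X' Y'(1) \<Omega> by blast
qed

section \<open>The forest of a germ\<close>

text \<open>The functions below take a germ as the list \<open>[a\<^sub>1, \<dots>, a\<^sub>k\<^sub>-\<^sub>1]\<close>, that is, reversed.\<close>

fun germ_code :: "nat list \<Rightarrow> bool" where
  "germ_code [] \<longleftrightarrow> True"
| "germ_code [a] \<longleftrightarrow> a \<le> 1"
| "germ_code (a # b # g) \<longleftrightarrow> a \<le> b + 1 \<and> germ_code (b # g)"

lemma germ_code_iff:
  "germ_code g \<longleftrightarrow> (g \<noteq> [] \<longrightarrow> last g \<le> 1) \<and> (\<forall>j. Suc j < length g \<longrightarrow> g ! j \<le> g ! Suc j + 1)"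
proof (induction g rule: germ_code.induct)
  case (3 a b g)
  show ?case unfolding germ_code.simps 3
    by (auto simp: nth_Cons split: nat.split)
qed auto

lemma entry_conv_rev: "1 \<le> i \<Longrightarrow> i \<le> length \<alpha> \<Longrightarrow> entry \<alpha> i = rev \<alpha> ! (i - 1)"
  by (simp add: entry_def rev_nth)

lemma set_entry_conv_rev:
  assumes "1 \<le> i" "i \<le> length \<alpha>"
  shows "set_entry \<alpha> i x = rev ((rev \<alpha>)[i - 1 := x])"
  using assms by (simp add: set_entry_def rev_update)

lemma is_germ_iff:
  assumes "1 < k"
  shows "is_germ k \<alpha> \<longleftrightarrow> length \<alpha> = k - 1 \<and> germ_code (rev \<alpha>)"
proof (cases "length \<alpha> = k - 1")
  case True
  have last: "last (rev \<alpha>) = entry \<alpha> (k - 1)" and ne: "\<alpha> \<noteq> []"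
    using True assms by (auto simp: entry_def last_rev intro!: hd_conv_nth)
  \<comment> \<open>The entries with indices i - 1 and i stand at positions j and j + 1 of the
    reversed list, where j = i - 2.\<close>
  have "(\<forall>i. 1 < i \<and> i < k \<longrightarrow> entry \<alpha> (i - 1) \<le> entry \<alpha> i + 1) \<longleftrightarrow>
        (\<forall>j. Suc j < length (rev \<alpha>) \<longrightarrow> rev \<alpha> ! j \<le> rev \<alpha> ! Suc j + 1)" (is "?L \<longleftrightarrow> ?R")
  proof (intro iffI allI impI)
    fix j assume L: ?L and j: "Suc j < length (rev \<alpha>)"
    then have "entry \<alpha> (j + 2 - 1) \<le> entry \<alpha> (j + 2) + 1" using True by (intro L[rule_format]) auto
    then show "rev \<alpha> ! j \<le> rev \<alpha> ! Suc j + 1" using j by (simp add: entry_conv_rev)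
  next
    fix i assume R: ?R and i: "1 < i \<and> i < k"
    then have "rev \<alpha> ! (i - 2) \<le> rev \<alpha> ! Suc (i - 2) + 1" using True by (intro R[rule_format]) auto
    moreover have "Suc (i - 2) = i - 1" "i - 1 - 1 = i - 2" using i by auto
    moreover have "entry \<alpha> (i - 1) = rev \<alpha> ! (i - 1 - 1)" "entry \<alpha> i = rev \<alpha> ! (i - 1)"
      using entry_conv_rev[of "i - 1" \<alpha>] entry_conv_rev[of i \<alpha>] i True by auto
    ultimately show "entry \<alpha> (i - 1) \<le> entry \<alpha> i + 1" by simp
  qed
  then show ?thesis using True last ne
    by (auto simp: is_germ_def germ_code_iff le_Suc_eq)
qed (simp add: is_germ_def)

text \<open>For a = 0 this is a common root above \<open>Q\<close>. Each increase of a moves the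
  last subtree of the last root to the front of the forest; after a moves the last a trees of
  \<open>Q\<close> stand there in their old order.\<close>

primrec forest :: "nat list \<Rightarrow> tree list" where
  "forest [] = [Node []]"
| "forest (a # g) =
    (let Q = forest g; m = length Q - a in drop m Q @ [Node (take m Q)])"

lemma length_forest_Cons: "a \<le> length (forest g) \<Longrightarrow> length (forest (a # g)) = a + 1"
  by (simp add: Let_def)

text \<open>\<open>forest (b # g)\<close> has b + 1 trees and \<open>forest []\<close> has one, so
  the germ inequality says precisely that there are a trees to move.\<close>

lemma germ_code_Cons: "germ_code (a # g) \<longleftrightarrow> germ_code g \<and> a \<le> length (forest g)"
  by (induction g arbitrary: a) (auto simp: length_forest_Cons simp del: forest.simps(2))

text \<open>An entry 0 moves nothing and only puts a common root below the forest.\<close>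

lemma forest_word_zeros:
  "forest_word (forest (replicate n 0 @ g)) =
     replicate n False @ forest_word (forest g) @ replicate n True"
  by (induction n) (auto simp: replicate_append_same)

lemma length_forest_word:
  "germ_code g \<Longrightarrow> length (forest_word (forest g)) = 2 * (length g + 1)"
proof (induction g)
  case (Cons a g)
  let ?Q = "forest g" and ?m = "length (forest g) - a"
  have "length (forest_word ?Q) = length (forest_word (take ?m ?Q)) + length (forest_word (drop ?m ?Q))"
    by (metis append_take_drop_id forest_word_simps(3) length_append)
  then show ?case using Cons by (simp add: germ_code_Cons Let_def)
qed simp

text \<open>Removing the last root turns \<open>A @ [Node B]\<close> into \<open>B @ A\<close>,
  which has one node less; the entry that restores it is \<open>length A\<close>.\<close>

lemma exists_forest:
  "ts \<noteq> [] \<Longrightarrow> \<exists>g. germ_code g \<and> forest g = ts"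
proof (induction "length (forest_word ts)" arbitrary: ts rule: less_induct)
  case less
  obtain A B where ts: "ts = A @ [Node B]"
    using less.prems by (metis rev_exhaust tree.exhaust)
  show ?case
  proof (cases "B @ A = []")
    case True
    then have "germ_code [] \<and> forest [] = ts" using ts by simp
    then show ?thesis by blast
  next
    case False
    then obtain g where g: "germ_code g" "forest g = B @ A"
      using less.hyps[of "B @ A"] by (auto simp: ts)
    then have "germ_code (length A # g) \<and> forest (length A # g) = ts"
      by (simp add: germ_code_Cons ts)
    then show ?thesis by blast
  qed
qed

section \<open>The rightmost nonzero entry in the reversed germ\<close>

lemma first_nonzero_split:
  fixes g :: "nat list"
  assumes "\<exists>a\<in>set g. a \<noteq> 0"
  obtains n a g' where "g = replicate n 0 @ Suc a # g'"
proof -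
  have "\<exists>n a g'. g = replicate n 0 @ Suc a # g'" using assms
  proof (induction g)
    case (Cons b g)
    show ?case
    proof (cases b)
      case 0
      then obtain n a g' where "g = replicate n 0 @ Suc a # g'" using Cons by auto
      then have "b # g = replicate (Suc n) 0 @ Suc a # g'" using 0 by simp
      then show ?thesis by blast
    next
      case (Suc c)
      then have "b # g = replicate 0 0 @ Suc c # g" by simp
      then show ?thesis by blast
    qed
  qed simp
  with that show ?thesis by blast
qed

lemma rightmost_nonzero_rev:
  "rightmost_nonzero (rev (replicate n 0 @ Suc a # g)) = n + 1"
  unfolding rightmost_nonzero_def
proof (rule Least_equality)
  fix i assume i: "1 \<le> i \<and> i \<le> length (rev (replicate n 0 @ Suc a # g)) \<and>
    entry (rev (replicate n 0 @ Suc a # g)) i \<noteq> 0"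
  then show "n + 1 \<le> i"
    by (auto simp: entry_conv_rev nth_append split: if_splits)
qed (simp add: entry_conv_rev nth_append)

lemma entry_rev_Suc: "entry (rev (replicate n 0 @ a # g)) (n + 1) = a"
  by (simp add: entry_conv_rev nth_append)

lemma set_entry_rev_Suc:
  "set_entry (rev (replicate n 0 @ a # g)) (n + 1) b = rev (replicate n 0 @ b # g)"
  by (simp add: set_entry_conv_rev list_update_append)

lemma germ_parent_rev:
  "germ_parent (rev (replicate n 0 @ Suc a # g)) = rev (replicate n 0 @ a # g)"
  unfolding germ_parent_def rightmost_nonzero_rev Let_def entry_rev_Suc set_entry_rev_Suc by simp

section \<open>The string of a germ\<close>

lemma split_at_Num_unique:
  assumes "A @ Num c # B = A' @ Num c # B'" "distinct (nums (A @ Num c # B))"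
  shows "A = A' \<and> B = B'"
proof -
  have "distinct (nums (A' @ Num c # B'))" using assms by simp
  then have "Num c \<notin> set A'" using set_nums[of A'] by auto
  moreover have "Num c \<notin> set A" using assms(2) set_nums[of A] by auto
  moreover have "Num c \<notin> set B" using assms(2) set_nums[of B] by auto
  ultimately show ?thesis using assms(1) by (simp add: append_Cons_eq_iff)
qed

text \<open>The lengths fix \<open>W\<close> and \<open>Z\<close>, the first entry of
  \<open>X\<close> fixes \<Omega>, and \<Omega> + 1 occurs only once. This gives the definite
  description in \<open>F\<close> its value.\<close>

lemma castling_unique:
  assumes "castling i s t" "castling i s t'" "distinct (nums s)"
  shows "t = t'"
proof -
  obtain W X Y Z c X' Y' where 1: "s = W @ X @ Y @ Z" "length W = i" "length Z = i"
    "X = Num c # X'" "Y = Num (c + 1) # Y'" "t = W @ Y @ X @ Z"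
    using assms(1) unfolding castling_def by blast
  obtain V X2 Y2 U d X2' Y2' where 2: "s = V @ X2 @ Y2 @ U" "length V = i" "length U = i"
    "X2 = Num d # X2'" "Y2 = Num (d + 1) # Y2'" "t' = V @ Y2 @ X2 @ U"
    using assms(2) unfolding castling_def by blast
  have e: "W @ X @ Y @ Z = V @ X2 @ Y2 @ U" using 1(1) 2(1) by simp
  then have "W = V" and e': "(X @ Y) @ Z = (X2 @ Y2) @ U" using 1(2) 2(2) by auto
  have XY: "X @ Y = X2 @ Y2" "Z = U"
    using e' 1(3) 2(3) append_eq_append_conv[of "X @ Y" "X2 @ Y2" Z U] by metis+
  then have "c = d" using 1(4) 2(4) by simp
  then have "X @ Num (c + 1) # Y' = X2 @ Num (c + 1) # Y2'" using XY(1) 1(5) 2(5) by simp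
  moreover have "distinct (nums (X @ Num (c + 1) # Y'))" using assms(3) 1(1,5) by auto
  ultimately have "X = X2 \<and> Y' = Y2'" by (rule split_at_Num_unique)
  then have "X = X2" "Y = Y2" using 1(5) 2(5) \<open>c = d\<close> by auto
  then show ?thesis using 1 2 \<open>W = V\<close> \<open>Z = U\<close> by simp
qed

text \<open>The invariant kept by castling. The shape shows only that enough up-steps come first;
  the last clause adds that they carry the labels of the chain \<open>W\<close>.\<close>

definition germ_string :: "nat list \<Rightarrow> bool" where
  "germ_string g \<longleftrightarrow> lexical (length g + 1) (F (rev g)) \<and>
     shape (F (rev g)) = False # forest_word (forest g) \<and>
     (\<forall>n g'. g = replicate n 0 @ g' \<longrightarrow> prefix (map Num [0..<n + 1]) (F (rev g)))"

lemma F_zeros: "\<forall>a\<in>set g. a = 0 \<Longrightarrow> F (rev g) = initial_string (length g + 1)"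
  by (subst F.simps) simp

lemma F_Suc:
  "F (rev (replicate n 0 @ Suc a # g)) =
     (THE t. castling (n + 1) (F (rev (replicate n 0 @ a # g))) t)"
  by (subst F.simps) (simp only: rightmost_nonzero_rev germ_parent_rev, simp)

lemma germ_string_zeros:
  assumes "\<forall>a\<in>set g. a = 0"
  shows "germ_string g"
proof -
  let ?k = "length g + 1"
  have g: "g = replicate (length g) 0" using assms by (simp add: replicate_length_same)
  have sh: "shape (map Num xs) = replicate (length xs) False" for xs
    by (induction xs) auto
  have "forest_word (forest g) = replicate ?k False @ replicate ?k True"
    using forest_word_zeros[of "length g" "[]"] g by (simp add: replicate_append_same)
  moreover have "shape (replicate ?k Ast) = replicate ?k True"
    by (simp add: shape_def)
  ultimately have "shape (initial_string ?k) = False # forest_word (forest g)"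
    unfolding initial_string_def shape_simps sh by simp
  moreover have "prefix (map Num [0..<n + 1]) (initial_string ?k)" if "n \<le> length g" for n
  proof -
    have "[0..<?k + 1] = [0..<n + 1] @ [n + 1..<?k + 1]"
      using that upt_add_eq_append[of 0 "n + 1" "?k - n"] by simp
    then show ?thesis unfolding initial_string_def by (simp del: upt_Suc)
  qed
  ultimately show ?thesis
    using lexical_initial_string[of ?k] unfolding germ_string_def F_zeros[OF assms] by auto
qed

text \<open>On forests, castling turns \<open>A @ [Node (B @ [t])]\<close> into
  \<open>t # A @ [Node B]\<close> above an unchanged chain: \<open>Y\<close> is the contour of t,
  and \<open>X\<close> is all that precedes it above the chain.\<close>

lemma F_step:
  assumes germ: "germ_code (replicate n 0 @ Suc a # g)"
    and str: "germ_string (replicate n 0 @ a # g)"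
  obtains \<Omega> X Y X' Y' where
    "F (rev (replicate n 0 @ a # g)) = map Num [0..<n + 1] @ X @ Y @ replicate (n + 1) Ast"
    "F (rev (replicate n 0 @ Suc a # g)) = map Num [0..<n + 1] @ Y @ X @ replicate (n + 1) Ast"
    "X = Num \<Omega> # X'" "Y = Num (\<Omega> + 1) # Y'" "n + 1 \<le> \<Omega>"
    "germ_string (replicate n 0 @ Suc a # g)"
proof -
  let ?W = "map Num [0..<n + 1]" and ?Z = "replicate (n + 1) Ast"
  let ?s = "F (rev (replicate n 0 @ a # g))" and ?t = "F (rev (replicate n 0 @ Suc a # g))"
  define k where "k = length (replicate n 0 @ a # g) + 1"
  \<comment> \<open>p is the position in \<open>Q\<close> of the tree t that moves when the entry
    grows from a to \<open>Suc a\<close>.\<close>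
  define Q p where "Q = forest g" and "p = length Q - Suc a"
  have "germ_code (Suc a # g)"
    using germ by (induction n) (auto simp: germ_code_Cons)
  then have a: "Suc a \<le> length Q" by (simp add: germ_code_Cons Q_def)
  then have p: "p < length Q" "length Q - a = Suc p" by (auto simp: p_def)
  define A B t where "A = drop (Suc p) Q" and "B = take p Q" and "t = Q ! p"
  have old: "forest (a # g) = A @ [Node (B @ [t])]"
    using p by (simp add: Let_def A_def B_def t_def take_Suc_conv_app_nth flip: Q_def)
  have new: "forest (Suc a # g) = t # A @ [Node B]"
    using p by (simp add: Let_def A_def B_def t_def Cons_nth_drop_Suc flip: Q_def p_def)
  have shs: "shape ?s = False # replicate n False @ forest_word A @ False # forest_word B @
      tree_word t @ True # replicate n True"
    using str forest_word_zeros[of n "a # g"] old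
    by (simp add: germ_string_def replicate_append_same del: forest.simps)
  have "prefix ?W ?s" using str unfolding germ_string_def by blast
  then obtain r where r: "?s = ?W @ r" by (auto simp: prefix_def)
  have shW: "shape ?W = replicate (n + 1) False"
    by (simp add: shape_def comp_def map_replicate_const del: upt_Suc)
  have "shape r = (forest_word A @ False # forest_word B) @ (tree_word t @ replicate (n + 1) True)"
    using shs unfolding r shape_simps shW by (simp add: replicate_append_same)
  then obtain X r' where X: "r = X @ r'" "shape X = forest_word A @ False # forest_word B"
    and r': "shape r' = tree_word t @ replicate (n + 1) True"
    by (rule shape_eq_append)
  from r' obtain Y Z where Y: "r' = Y @ Z" "shape Y = tree_word t"
    and "shape Z = replicate (n + 1) True"
    by (rule shape_eq_append)
  then have "Z = ?Z" by (intro shape_eq_replicate_True)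
  then have s: "?s = ?W @ X @ Y @ ?Z" using r X Y by simp
  have "lexical k ?s" using str by (simp add: germ_string_def k_def)
  then have lex: "lexical k (?W @ X @ Y @ ?Z)" by (simp only: s)
  obtain \<Omega> X' Y' where XY: "X = Num \<Omega> # X'" "Y = Num (\<Omega> + 1) # Y'" "n + 1 \<le> \<Omega>"
    and lex': "lexical k (?W @ Y @ X @ ?Z)"
    using castling_swap[OF lex refl X(2) Y(2)] by blast
  have c: "castling (n + 1) ?s (?W @ Y @ X @ ?Z)"
    unfolding castling_def
    by (rule exI[of _ ?W], rule exI[of _ X], rule exI[of _ Y], rule exI[of _ ?Z],
        rule exI[of _ \<Omega>], rule exI[of _ X'], rule exI[of _ Y'])
       (use s XY in \<open>simp del: upt_Suc replicate_Suc\<close>)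
  have "distinct (nums ?s)" using lex s by (simp add: lexical_def)
  then have t: "?t = ?W @ Y @ X @ ?Z"
    unfolding F_Suc using castling_unique c by (intro the_equality) blast+
  have "lexical k ?t" using lex' by (simp only: t)
  moreover have "shape ?t = False # forest_word (forest (replicate n 0 @ Suc a # g))"
    unfolding t shape_simps shW X Y forest_word_zeros new
    by (simp add: shape_def replicate_append_same)
  moreover have "prefix (map Num [0..<m + 1]) ?t" if "replicate n 0 @ Suc a # g = replicate m 0 @ g'"
    for m g'
  proof -
    \<comment> \<open>Position n holds \<open>Suc a\<close>, so the block of zeros cannot extend
      over it.\<close>
    have "m \<le> n"
    proof (rule ccontr)
      assume "\<not> m \<le> n"
      then have "(replicate m 0 @ g') ! n = 0" by (simp add: nth_append)
      then show False unfolding that[symmetric] by (simp add: nth_append)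
    qed
    then have "[0..<n + 1] = [0..<m + 1] @ [m + 1..<n + 1]"
      using upt_add_eq_append[of 0 "m + 1" "n - m"] by simp
    then show ?thesis unfolding t by (simp del: upt_Suc)
  qed
  ultimately have "germ_string (replicate n 0 @ Suc a # g)"
    by (auto simp: germ_string_def k_def)
  then show ?thesis using that s t XY by blast
qed

text \<open>Lowering an entry could only violate the bound it imposes on the entry before it in the
  list, and that entry is 0 or absent.\<close>

lemma germ_code_decrease:
  assumes "germ_code (replicate n 0 @ Suc a # g)"
  shows "germ_code (replicate n 0 @ a # g)"
proof (cases n)
  case 0
  then show ?thesis using assms by (simp add: germ_code_Cons)
next
  case (Suc m)
  have "germ_code (a # g)"
    using assms by (induction n) (auto simp: germ_code_Cons)
  then show ?thesis by (induction n) (auto simp: germ_code_Cons)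
qed

lemma germ_string_germ: "germ_code g \<Longrightarrow> germ_string g"
proof (induction "sum_list g" arbitrary: g rule: less_induct)
  case less
  show ?case
  proof (cases "\<forall>a\<in>set g. a = 0")
    case True
    then show ?thesis by (rule germ_string_zeros)
  next
    case False
    then obtain n a g' where g: "g = replicate n 0 @ Suc a # g'" using first_nonzero_split by metis
    have "germ_string (replicate n 0 @ a # g')"
      using less germ_code_decrease by (auto simp: g)
    then show ?thesis using F_step less.prems unfolding g by blast
  qed
qed

section \<open>Lexical colors\<close>

lemma ht_take: "p \<le> length w \<Longrightarrow> ht (take p w) = (\<Sum>j<p. if w ! j then - 1 else 1)"
  by (induction p) (simp_all add: take_Suc_conv_app_nth)

lemma cyclic_interval_less:
  assumes "y < x" "x < n"
  shows "cyclic_interval n y x = {y..<x}"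
proof -
  have "x + n - y = x - y + n" using assms by simp
  then have m: "(x + n - y) mod n = x - y" using assms by (simp only: mod_add_self2) simp
  show ?thesis
  proof (rule set_eqI, rule iffI)
    fix z assume "z \<in> {y..<x}"
    then have "z = (y + (z - y)) mod n" "z - y < x - y" using assms by auto
    then show "z \<in> cyclic_interval n y x" unfolding cyclic_interval_def m by blast
  qed (use assms in \<open>auto simp: cyclic_interval_def m\<close>)
qed

lemma cyclic_interval_greater:
  assumes "x < y" "y < n"
  shows "cyclic_interval n y x = {y..<n} \<union> {..<x}"
proof -
  have m: "(x + n - y) mod n = x + n - y" using assms by simp
  show ?thesis
  proof (rule set_eqI, rule iffI)
    fix z assume "z \<in> {y..<n} \<union> {..<x}"
    then consider "y \<le> z" "z < n" | "z < x" by auto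
    then show "z \<in> cyclic_interval n y x"
    proof cases
      case 1
      then have "z = (y + (z - y)) mod n" "z - y < x + n - y" using assms by auto
      then show ?thesis unfolding cyclic_interval_def m by blast
    next
      case 2
      then have "y + (z + n - y) = z + n" using assms by simp
      then have "z = (y + (z + n - y)) mod n" "z + n - y < x + n - y" using assms 2 by auto
      then show ?thesis unfolding cyclic_interval_def m by blast
    qed
  next
    fix z assume "z \<in> cyclic_interval n y x"
    then obtain j where j: "z = (y + j) mod n" "j < x + n - y" by (auto simp: cyclic_interval_def m)
    show "z \<in> {y..<n} \<union> {..<x}"
    proof (cases "y + j < n")
      case False
      then have "z = y + j - n" using j assms by (simp add: mod_if)
      then show ?thesis using j False by auto
    qed (use j in auto)
  qed
qed

lemma sum_sign_eq_card_diff: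
  fixes w :: "bool list"
  assumes "I \<subseteq> {..<length w}"
  shows "(\<Sum>j\<in>I. if w ! j then - 1 else 1) =
     int (card (I \<inter> {i. i < length w \<and> \<not> w ! i})) - int (card (I \<inter> {i. i < length w \<and> w ! i}))"
proof -
  have "finite I" using assms finite_subset by blast
  moreover have "I \<inter> {i. i < length w \<and> \<not> w ! i} = I \<inter> - {j. w ! j}"
    "I \<inter> {i. i < length w \<and> w ! i} = I \<inter> {j. w ! j}" using assms by auto
  ultimately show ?thesis by (simp add: sum.If_cases)
qed

text \<open>The excess of 0s over 1s on the interval is a difference of heights. If the interval
  wraps around, the total height 1 is added, which makes the strict inequality weak.\<close>

lemma cyclic_interval_majority:
  fixes w :: "bool list"
  defines "n \<equiv> length w"
  assumes "ht w = 1" "x < n" "y < n" "x \<noteq> y"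
  shows "card (cyclic_interval n y x \<inter> {i. i < n \<and> w ! i}) <
         card (cyclic_interval n y x \<inter> {i. i < n \<and> \<not> w ! i}) \<longleftrightarrow>
         (if y < x then ht (take y w) < ht (take x w) else ht (take y w) \<le> ht (take x w))"
proof -
  let ?f = "\<lambda>j. if w ! j then - 1 else 1 :: int" and ?I = "cyclic_interval n y x"
  have I: "?I \<subseteq> {..<length w}"
  proof -
    have "w \<noteq> []" using assms(3) by (auto simp: n_def)
    then show ?thesis by (auto simp: cyclic_interval_def n_def)
  qed
  have split: "sum ?f {..<b} = sum ?f {..<a} + sum ?f {a..<b}" if "a \<le> b" for a b
    using that by (metis atLeast0LessThan le0 sum.atLeastLessThan_concat)
  have ht: "ht (take p w) = sum ?f {..<p}" if "p \<le> n" for p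
    using that ht_take by (simp add: n_def)
  have "sum ?f ?I = (if y < x then ht (take x w) - ht (take y w)
                     else 1 + ht (take x w) - ht (take y w))"
  proof (cases "y < x")
    case True
    then show ?thesis using assms split[of y x] by (simp add: cyclic_interval_less ht)
  next
    case False
    then have "x < y" using assms by simp
    then have "sum ?f ?I = sum ?f {y..<n} + sum ?f {..<x}"
      using assms by (subst cyclic_interval_greater) (auto intro: sum.union_disjoint)
    then show ?thesis using False assms split[of y n] ht[of n] ht[of x] ht[of y]
      by (simp add: n_def)
  qed
  then show ?thesis using sum_sign_eq_card_diff[OF I] by (auto simp: n_def)
qed

lemma lexical_nth:
  assumes "lexical k s" "p < q" "q < length s" "s ! p = Num a" "s ! q = Num b"
  shows "a \<noteq> b" "a < b \<longleftrightarrow> ht (take p (shape s)) < ht (take q (shape s))"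
proof -
  define B where "B = drop (Suc p) (take q s)"
  have "take q s = take p (take q s) @ take q s ! p # drop (Suc p) (take q s)"
    using assms by (intro id_take_nth_drop) simp
  then have tq: "take q s = take p s @ Num a # B"
    using assms by (simp add: B_def min_def)
  have s: "s = take p s @ Num a # B @ Num b # drop (Suc q) s"
    using id_take_nth_drop[of q s] assms(3,5) by (simp add: tq)
  have lex: "lexical k (take p s @ Num a # B @ Num b # drop (Suc q) s)"
    using assms(1) s by simp
  then show "a \<noteq> b" by (auto simp: lexical_def)
  have sh: "take m (shape s) = shape (take m s)" for m by (simp add: shape_def take_map)
  have "ranked (ht (shape (take p s)), a) (ht (shape (take q s)), b)"
    using lex by (simp add: lexical_def tq sorted_wrt_append algebra_simps)
  then show "a < b \<longleftrightarrow> ht (take p (shape s)) < ht (take q (shape s))"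
    by (simp add: ranked_def sh)
qed

text \<open>The height comparison of \<open>cyclic_interval_majority\<close>, strict on the left and
  weak on the right, is the one prescribed by \<open>ranked\<close>. So the positions counted for
  the label a are those with smaller labels, and there are a of these.\<close>

lemma labelling_shape:
  assumes lex: "lexical k s" and ht: "ht (shape s) = 1"
  shows "labelling (shape s) = s"
proof (rule nth_equalityI)
  let ?w = "shape s" and ?n = "length s"
  fix p assume "p < length (labelling ?w)"
  then have p: "p < ?n" by (simp add: labelling_def)
  have sh: "?w ! i \<longleftrightarrow> s ! i = Ast" if "i < ?n" for i using that by (simp add: shape_def)
  have lab: "labelling ?w ! p = (if ?w ! p then Ast else Num (lexical_color ?w p))"
    using p by (simp add: labelling_def)
  show "labelling ?w ! p = s ! p"
  proof (cases "s ! p")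
    case (Num a)
    define C where "C = {y. y < ?n \<and> (\<exists>b<a. s ! y = Num b)}"
    have "lexical_color ?w p = card C"
    proof -
      have "y < ?n \<and> \<not> ?w ! y \<and> y \<noteq> p \<and>
          card (cyclic_interval ?n y p \<inter> {i. i < ?n \<and> ?w ! i}) <
          card (cyclic_interval ?n y p \<inter> {i. i < ?n \<and> \<not> ?w ! i}) \<longleftrightarrow> y \<in> C" for y
      proof (cases "y < ?n \<and> \<not> ?w ! y \<and> y \<noteq> p")
        case True
        then obtain b where b: "s ! y = Num b" using sh[of y] by (cases "s ! y") auto
        then show ?thesis
          using cyclic_interval_majority[of ?w p y] ht True p Num
            lexical_nth[OF lex, of y p b a] lexical_nth[OF lex, of p y a b]
          by (cases "y < p") (auto simp: C_def)
      qed (use sh Num in \<open>auto simp: C_def\<close>)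
      then have "{y \<in> {i. i < ?n \<and> \<not> ?w ! i} - {p}.
          card (cyclic_interval ?n y p \<inter> {i. i < ?n \<and> ?w ! i}) <
          card (cyclic_interval ?n y p \<inter> {i. i < ?n \<and> \<not> ?w ! i})} = C"
        by auto
      then show ?thesis by (simp add: lexical_color_def Let_def)
    qed
    also have "card C = card (nth s ` C)"
    proof (rule card_image[symmetric], rule inj_onI)
      fix x y assume "x \<in> C" "y \<in> C" "s ! x = s ! y"
      moreover from this obtain b where "s ! x = Num b" "s ! y = Num b" by (auto simp: C_def)
      ultimately show "x = y" using lexical_nth(1)[OF lex] unfolding C_def
        by (metis (no_types, lifting) linorder_neqE_nat mem_Collect_eq)
    qed
    also have "nth s ` C = Num ` {..<a}"
    proof -
      have "Num a \<in> set s" using p Num nth_mem by metis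
      moreover have set: "Num b \<in> set s \<longleftrightarrow> b \<le> k" for b
      proof -
        have "b \<in> set (nums s) \<longleftrightarrow> b \<in> {..k}" using lex unfolding lexical_def by blast
        then show ?thesis by (simp add: set_nums)
      qed
      ultimately have "Num b \<in> set s" if "b < a" for b using that by simp
      moreover have "\<exists>y\<in>C. s ! y = Num b" if "b < a" "Num b \<in> set s" for b
        using that by (auto simp: C_def in_set_conv_nth)
      ultimately have "Num ` {..<a} \<subseteq> nth s ` C" by force
      moreover have "nth s ` C \<subseteq> Num ` {..<a}" by (auto simp: C_def)
      ultimately show ?thesis by blast
    qed
    also have "card (Num ` {..<a}) = a" by (simp add: card_image inj_on_def)
    finally show ?thesis using lab sh[OF p] Num by simp
  qed (simp add: lab sh[OF p])
qed (simp add: labelling_def)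

section \<open>Translation\<close>

lemma mod_Suc_diff:
  assumes "x < n" "y < (n::nat)"
  shows "(Suc x mod n + n - Suc y mod n) mod n = (x + n - y) mod n"
proof -
  have "int ((Suc x mod n + n - Suc y mod n) mod n) = int ((x + n - y) mod n)"
    using assms by (cases "Suc x = n"; cases "Suc y = n") (auto simp: mod_if)
  then show ?thesis by simp
qed

lemma cyclic_interval_Suc:
  assumes "x < n" "y < n"
  shows "cyclic_interval n (Suc y mod n) (Suc x mod n) = (\<lambda>i. Suc i mod n) ` cyclic_interval n y x"
proof -
  have "(Suc y mod n + j) mod n = Suc ((y + j) mod n) mod n" for j
    by (simp add: mod_simps)
  then show ?thesis
    unfolding cyclic_interval_def mod_Suc_diff[OF assms] by auto
qed

lemma inj_on_Suc_mod: "inj_on (\<lambda>i. Suc i mod n) {..<n}"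
  by (rule inj_onI) (auto simp: mod_Suc split: if_splits)

lemma image_Suc_mod: "(\<lambda>i. Suc i mod n) ` {..<n} = {..<n}"
  by (rule endo_inj_surj) (auto intro: inj_on_Suc_mod)

text \<open>The cyclic successor maps intervals, 0-positions and 1-positions of the rotated word
  bijectively to those of the original, so the counted sets are equinumerous.\<close>

lemma lexical_color_rotate1:
  assumes "x < length b"
  shows "lexical_color (rotate1 b) x = lexical_color b (Suc x mod length b)"
proof -
  define n where "n = length b"
  let ?f = "\<lambda>i. Suc i mod n" and ?b' = "rotate1 b"
  have nth: "?b' ! i = b ! ?f i" if "i < n" for i using that nth_rotate1 by (simp add: n_def)
  have im: "{i. i < n \<and> P (b ! i)} = ?f ` {i. i < n \<and> P (?b' ! i)}" for P
  proof -
    have "{i. i < n \<and> P (b ! i)} = {i \<in> ?f ` {..<n}. P (b ! i)}" by (auto simp: image_Suc_mod)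
    also have "\<dots> = ?f ` {i. i < n \<and> P (?b' ! i)}" using nth by auto
    finally show ?thesis .
  qed
  have card: "card (cyclic_interval n (?f y) (?f x) \<inter> {i. i < n \<and> P (b ! i)}) =
      card (cyclic_interval n y x \<inter> {i. i < n \<and> P (?b' ! i)})" if "y < n" for y P
  proof -
    have sub: "cyclic_interval n y x \<subseteq> {..<n}" using that by (auto simp: cyclic_interval_def)
    have "cyclic_interval n (?f y) (?f x) \<inter> {i. i < n \<and> P (b ! i)} =
        ?f ` (cyclic_interval n y x \<inter> {i. i < n \<and> P (?b' ! i)})"
      unfolding im[of P] using assms that sub
      by (subst cyclic_interval_Suc) (auto simp: n_def intro!: inj_on_image_Int[OF inj_on_Suc_mod, symmetric])
    then show ?thesis
      using sub card_image[OF inj_on_subset[OF inj_on_Suc_mod]] by (metis (no_types, lifting) inf.coboundedI1)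
  qed
  define A where "A = {y \<in> {i. i < n \<and> \<not> ?b' ! i} - {x}.
      card (cyclic_interval n y x \<inter> {i. i < n \<and> ?b' ! i}) <
      card (cyclic_interval n y x \<inter> {i. i < n \<and> \<not> ?b' ! i})}"
  define B where "B = {y \<in> {i. i < n \<and> \<not> b ! i} - {?f x}.
      card (cyclic_interval n y (?f x) \<inter> {i. i < n \<and> b ! i}) <
      card (cyclic_interval n y (?f x) \<inter> {i. i < n \<and> \<not> b ! i})}"
  have f_less: "?f y < n" for y
    using assms unfolding n_def by (intro mod_less_divisor) linarith
  have "?f y \<in> B \<longleftrightarrow> y \<in> A" if "y < n" for y
    using that assms f_less[of y] card[of y "\<lambda>x. x"] card[of y "\<lambda>x. \<not> x"] nth[of y] inj_on_Suc_mod[of n]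
    by (auto simp: A_def B_def n_def inj_on_def)
  moreover have "A \<subseteq> {..<n}" "B \<subseteq> ?f ` {..<n}" unfolding image_Suc_mod by (auto simp: A_def B_def)
  ultimately have "B = ?f ` A" by blast
  moreover have "inj_on ?f A" using inj_on_subset[OF inj_on_Suc_mod \<open>A \<subseteq> {..<n}\<close>] .
  ultimately have "card A = card B" by (simp add: card_image)
  then show ?thesis by (simp add: lexical_color_def Let_def A_def B_def n_def)
qed

lemma labelling_rotate1: "labelling (rotate1 b) = rotate1 (labelling b)"
proof (rule nth_equalityI)
  fix i assume "i < length (labelling (rotate1 b))"
  then have i: "i < length b" by (simp add: labelling_def)
  then have "Suc i mod length b < length b" by (intro mod_less_divisor) linarith
  with i show "labelling (rotate1 b) ! i = rotate1 (labelling b) ! i"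
    by (simp add: labelling_def nth_rotate1 lexical_color_rotate1)
qed (simp add: labelling_def)

lemma labelling_rotate: "labelling (rotate m b) = rotate m (labelling b)"
  by (induction m) (simp_all add: labelling_rotate1)

lemma from_zero_Num_0 [simp]: "from_zero (Num 0 # s) = Num 0 # s"
  by (simp add: from_zero_def)

lemma from_zero_rotate:
  assumes "distinct (nums (Num 0 # s))"
  shows "from_zero (rotate m (Num 0 # s)) = Num 0 # s"
proof (cases "m mod length (Num 0 # s)")
  case 0
  then show ?thesis by (simp add: rotate_drop_take)
next
  case (Suc j)
  have "Num 0 \<notin> set s" using assms by (simp add: set_nums)
  then have "\<forall>l\<in>set (drop j s). l \<noteq> Num 0" by (metis in_set_dropD)
  then show ?thesis using Suc unfolding rotate_drop_take from_zero_def
    by (simp add: takeWhile_append dropWhile_append)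
qed

text \<open>Rotation commutes with \<open>labelling\<close>, and starting at the unique 0 undoes it,
  so all representatives give one string and \<open>the_elem\<close> meets a singleton.\<close>

lemma delta_translates_shape:
  assumes lex: "lexical k s" and "ht (shape s) = 1" and s: "s = Num 0 # s'"
  shows "delta (translates (shape s)) = s"
proof -
  have "from_zero (labelling (rotate m (shape s))) = s" for m
    using labelling_shape[OF assms(1,2)] from_zero_rotate[of s' m] lex s
    by (simp add: labelling_rotate lexical_def)
  then have "(\<lambda>b. from_zero (labelling b)) ` translates (shape s) = {s}"
    by (force simp: translates_def image_iff)
  then show ?thesis by (simp add: delta_def)
qed

lemma translates_rotate: "translates (rotate m b) = translates b"
proof -
  have "b = rotate (length b - m mod length b) (rotate m b)"
  proof (cases "b = []")
    case False
    then have "m mod length b < length b" by simp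
    then have "rotate (length b - m mod length b) (rotate (m mod length b) b) = rotate (length b) b"
      by (simp add: rotate_rotate)
    then show ?thesis by (metis rotate_conv_mod rotate_length01 rotate_id mod_self)
  qed simp
  then have "rotate j b = rotate (j + (length b - m mod length b)) (rotate m b)" for j
    by (metis rotate_rotate)
  then show ?thesis by (auto simp: translates_def rotate_rotate)
qed

section \<open>Rotating a word of height 1 to a forest contour\<close>

definition segment :: "bool \<Rightarrow> tree list \<Rightarrow> bool list" where
  "segment x ts = x # forest_word ts"

text \<open>Cancelling matching pairs of \<open>0\<close> and \<open>1\<close> leaves \<open>1\<close>s followed by \<open>0\<close>s.\<close>

lemma exists_segments:
  "\<exists>Q Rs Ss. w = forest_word Q @ concat (map (segment True) Rs) @ concat (map (segment False) Ss)"
proof (induction w rule: rev_induct)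
  case Nil
  have "[] = forest_word [] @ concat (map (segment True) []) @ concat (map (segment False) [])" by simp
  then show ?case by blast
next
  case (snoc x w)
  then obtain Q Rs Ss where
    w: "w = forest_word Q @ concat (map (segment True) Rs) @ concat (map (segment False) Ss)"
    by blast
  show ?case
  proof (cases x)
    case False
    then have "w @ [x] = forest_word Q @ concat (map (segment True) Rs) @
        concat (map (segment False) (Ss @ [[]]))"
      using w by (simp add: segment_def)
    then show ?thesis by blast
  next
    case True
    show ?thesis
    proof (cases Ss rule: rev_cases)
      case Nil
      then have "w @ [x] = forest_word Q @ concat (map (segment True) (Rs @ [[]])) @
          concat (map (segment False) [])"
        using w True by (simp add: segment_def)
      then show ?thesis by blast
    next
      \<comment> \<open>The new 1 closes the last unmatched 0 to the tree \<open>Node S\<close>,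
        which joins the segment before it: that of another unmatched 0, else that of the last
        unmatched 1, else the initial forest \<open>Q\<close>.\<close>
      case (snoc Ss' S)
      show ?thesis
      proof (cases Ss' rule: rev_cases)
        case (snoc Ss'' S')
        then have "w @ [x] = forest_word Q @ concat (map (segment True) Rs) @
            concat (map (segment False) (Ss'' @ [S' @ [Node S]]))"
          using w True \<open>Ss = Ss' @ [S]\<close> by (simp add: segment_def)
        then show ?thesis by blast
      next
        case Nil
        show ?thesis
        proof (cases Rs rule: rev_cases)
          case (snoc Rs' R)
          then have "w @ [x] = forest_word Q @ concat (map (segment True) (Rs' @ [R @ [Node S]])) @
              concat (map (segment False) [])"
            using w True \<open>Ss = Ss' @ [S]\<close> Nil by (simp add: segment_def)
          then show ?thesis by blast
        next
          case 2: Nil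
          then have "w @ [x] = forest_word (Q @ [Node S]) @ concat (map (segment True) []) @
              concat (map (segment False) [])"
            using w True \<open>Ss = Ss' @ [S]\<close> Nil by (simp add: segment_def)
          then show ?thesis by blast
        qed
      qed
    qed
  qed
qed

lemma join_segments:
  "length Ss = Suc (length Rs) \<Longrightarrow>
     \<exists>ts. concat (map (segment False) Ss) @ forest_word Q @ concat (map (segment True) Rs) =
       False # forest_word ts"
proof (induction Rs arbitrary: Ss Q)
  case Nil
  then obtain S where "Ss = [S]" by (metis length_0_conv length_Suc_conv)
  then have "concat (map (segment False) Ss) @ forest_word Q @ concat (map (segment True) []) =
      False # forest_word (S @ Q)" by (simp add: segment_def)
  then show ?case by blast
next
  case (Cons R Rs)
  obtain Ss' S where Ss: "Ss = Ss' @ [S]" using Cons.prems by (cases Ss rule: rev_cases) auto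
  obtain Ss'' S' where Ss': "Ss' = Ss'' @ [S']"
    using Cons.prems Ss by (cases Ss' rule: rev_cases) auto
  \<comment> \<open>The innermost unmatched 0 and 1 close around \<open>S @ Q\<close>; the new tree
    and \<open>R\<close> join the segment of the preceding 0, which leaves an empty middle
    forest.\<close>
  have eq: "concat (map (segment False) Ss) @ forest_word Q @ concat (map (segment True) (R # Rs)) =
      concat (map (segment False) (Ss'' @ [S' @ Node (S @ Q) # R])) @ forest_word [] @
      concat (map (segment True) Rs)"
    unfolding Ss Ss' by (simp add: segment_def)
  have "length (Ss'' @ [S' @ Node (S @ Q) # R]) = Suc (length Rs)"
    using Cons.prems Ss Ss' by simp
  then show ?case unfolding eq by (rule Cons.IH)
qed

text \<open>A form of the cycle lemma: height 1 means one more unmatched 0 than unmatched 1s. Once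
  the unmatched 0s are rotated to the front, all but the first get matched.\<close>

lemma exists_rotation_to_forest:
  assumes "ht w = 1"
  obtains m ts where "rotate m w = False # forest_word ts"
proof -
  obtain Q Rs Ss where
    w: "w = (forest_word Q @ concat (map (segment True) Rs)) @ concat (map (segment False) Ss)"
    using exists_segments[of w] by auto
  have "ht (concat (map (segment True) Rs)) = - int (length Rs)"
    by (induction Rs) (auto simp: segment_def)
  moreover have "ht (concat (map (segment False) Ss)) = int (length Ss)"
    by (induction Ss) (auto simp: segment_def)
  ultimately have "length Ss = Suc (length Rs)" using assms w by simp
  then obtain ts where "concat (map (segment False) Ss) @ forest_word Q @ concat (map (segment True) Rs) =
      False # forest_word ts" using join_segments by blast
  then show ?thesis using that unfolding w by (metis rotate_append)
qed

section \<open>Classes and germs\<close>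

lemma germ_string_is_germ:
  assumes "1 < k" "is_germ k \<alpha>"
  shows "lexical k (F \<alpha>)" "shape (F \<alpha>) = False # forest_word (forest (rev \<alpha>))"
    "\<exists>s. F \<alpha> = Num 0 # s"
proof -
  have \<alpha>: "length \<alpha> = k - 1" "germ_code (rev \<alpha>)" using assms is_germ_iff by auto
  then have str: "germ_string (rev \<alpha>)" by (intro germ_string_germ)
  then show "lexical k (F \<alpha>)" "shape (F \<alpha>) = False # forest_word (forest (rev \<alpha>))"
    using \<alpha> assms by (auto simp: germ_string_def)
  have "rev \<alpha> = replicate 0 0 @ rev \<alpha>" by simp
  then have "prefix (map Num [0..<0 + 1]) (F (rev (rev \<alpha>)))"
    using str unfolding germ_string_def by blast
  then show "\<exists>s. F \<alpha> = Num 0 # s" by (auto simp: prefix_def)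
qed

definition germ_class :: "nat list \<Rightarrow> bool list set" where
  "germ_class \<alpha> = translates (shape (F \<alpha>))"

lemma ht_conv_filter: "ht w = int (length w) - 2 * int (length (filter id w))"
  by (induction w) auto

lemma delta_germ_class:
  assumes "1 < k" "is_germ k \<alpha>"
  shows "delta (germ_class \<alpha>) = F \<alpha>"
proof -
  obtain s where "F \<alpha> = Num 0 # s" using germ_string_is_germ[OF assms] by blast
  then show ?thesis unfolding germ_class_def
    using germ_string_is_germ[OF assms] delta_translates_shape[of k "F \<alpha>" s] by simp
qed

lemma germ_class_in_L_mod_pi:
  assumes "1 < k" "is_germ k \<alpha>"
  shows "germ_class \<alpha> \<in> L_mod_pi k"
proof -
  have sh: "shape (F \<alpha>) = False # forest_word (forest (rev \<alpha>))"
    using germ_string_is_germ[OF assms] by simp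
  moreover have "length (forest_word (forest (rev \<alpha>))) = 2 * k"
    using assms by (subst length_forest_word) (auto simp: is_germ_iff)
  moreover have "ht (shape (F \<alpha>)) = 1" unfolding sh by simp
  ultimately have "shape (F \<alpha>) \<in> L k"
    using ht_conv_filter[of "shape (F \<alpha>)"] by (simp add: L_def del: shape_simps)
  then show ?thesis by (simp add: germ_class_def L_mod_pi_def)
qed

text \<open>A representative is rotated to a contour, whose forest comes from a germ by
  \<open>exists_forest\<close>; the contour length 2k gives the germ length k - 1.\<close>

lemma exists_germ_class:
  assumes "1 < k" "v \<in> L_mod_pi k"
  obtains \<alpha> where "is_germ k \<alpha>" "v = germ_class \<alpha>"
proof -
  obtain b where b: "b \<in> L k" "v = translates b" using assms(2) by (auto simp: L_mod_pi_def)
  then have "ht b = 1" by (simp add: L_def ht_conv_filter)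
  then obtain m ts where m: "rotate m b = False # forest_word ts" by (rule exists_rotation_to_forest)
  then have "length (False # forest_word ts) = 2 * k + 1"
    using b(1) length_rotate[of m b] by (simp add: L_def)
  then have len: "length (forest_word ts) = 2 * k" by simp
  then have "ts \<noteq> []" using assms(1) by auto
  then obtain g where g: "germ_code g" "forest g = ts" using exists_forest by blast
  then have "is_germ k (rev g)"
    using assms(1) len length_forest_word[of g] by (simp add: is_germ_iff)
  moreover have "shape (F (rev g)) = rotate m b"
    using germ_string_is_germ(2)[OF assms(1) \<open>is_germ k (rev g)\<close>] g m by simp
  then have "germ_class (rev g) = v" using b translates_rotate by (simp add: germ_class_def)
  ultimately show ?thesis using that by blast
qed

text \<open>Both classes come from germs, and the shape of \<open>F\<close> recovers the
  class.\<close>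

lemma delta_inject:
  assumes "1 < k" "v \<in> L_mod_pi k" "v' \<in> L_mod_pi k" "delta v = delta v'"
  shows "v = v'"
  using assms by (metis delta_germ_class exists_germ_class germ_class_def)

section \<open>The initial chain of the string of a germ\<close>

lemma W_index_eq:
  assumes "l \<noteq> Num (n + 1)"
  shows "W_index (map Num [0..<n + 1] @ l # s) = n"
  unfolding W_index_def
proof (rule Greatest_equality)
  fix y assume "prefix (map Num [0..<y + 1]) (map Num [0..<n + 1] @ l # s)"
  then obtain r where r: "map Num [0..<n + 1] @ l # s = map Num [0..<y + 1] @ r"
    by (auto simp: prefix_def)
  show "y \<le> n"
  proof (rule ccontr)
    assume y: "\<not> y \<le> n"
    then have "(map Num [0..<y + 1] @ r) ! (n + 1) = Num (n + 1)"
      by (simp add: nth_append del: upt_Suc)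
    moreover have "(map Num [0..<n + 1] @ l # s) ! (n + 1) = l"
      by (simp add: nth_append del: upt_Suc)
    ultimately show False using assms r by simp
  qed
qed simp

lemma W_index_initial_string: "0 < k \<Longrightarrow> W_index (initial_string k) = k"
  using W_index_eq[of Ast k "replicate (k - 1) Ast"]
  by (cases k) (simp_all add: initial_string_def del: upt_Suc)

lemma from_zero_F: "1 < k \<Longrightarrow> is_germ k \<alpha> \<Longrightarrow> from_zero (F \<alpha>) = F \<alpha>"
  using germ_string_is_germ(3) by fastforce

lemma from_zero_initial_string: "from_zero (initial_string k) = initial_string k"
  by (simp add: initial_string_def upt_conv_Cons del: upt_Suc)

text \<open>Supplies the blocks of the last castling in the construction of
  \<open>F \<alpha>\<close>, from which the first uncastling step is read off.\<close>

lemma nonzero_germ_cases: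
  assumes "1 < k" "is_germ k \<alpha>" "sum_list \<alpha> \<noteq> 0"
  obtains n a \<beta> \<Omega> X Y X' Y' where
    "\<alpha> = \<beta> @ Suc a # replicate n 0" "germ_parent \<alpha> = \<beta> @ a # replicate n 0"
    "is_germ k (germ_parent \<alpha>)" "n < k" "W_index (F \<alpha>) = n"
    "F (germ_parent \<alpha>) = map Num [0..<n + 1] @ X @ Y @ replicate (n + 1) Ast"
    "F \<alpha> = map Num [0..<n + 1] @ Y @ X @ replicate (n + 1) Ast"
    "X = Num \<Omega> # X'" "Y = Num (\<Omega> + 1) # Y'" "n + 1 \<le> \<Omega>"
proof -
  have "\<exists>x\<in>set (rev \<alpha>). x \<noteq> 0" using assms(3) by auto
  then obtain n a g where g: "rev \<alpha> = replicate n 0 @ Suc a # g" by (rule first_nonzero_split)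
  then have \<alpha>: "\<alpha> = rev (replicate n 0 @ Suc a # g)" by (metis rev_rev_ident)
  have germ: "germ_code (replicate n 0 @ Suc a # g)" and len: "length \<alpha> = k - 1"
    using assms(1,2) g by (auto simp: is_germ_iff)
  have parent: "germ_parent \<alpha> = rev (replicate n 0 @ a # g)"
    unfolding \<alpha> by (rule germ_parent_rev)
  have germ': "germ_code (replicate n 0 @ a # g)" using germ by (rule germ_code_decrease)
  then have "is_germ k (germ_parent \<alpha>)"
    using assms(1) len unfolding parent by (simp add: is_germ_iff \<alpha>)
  moreover obtain \<Omega> X Y X' Y' where F:
    "F (rev (replicate n 0 @ a # g)) = map Num [0..<n + 1] @ X @ Y @ replicate (n + 1) Ast"
    "F (rev (replicate n 0 @ Suc a # g)) = map Num [0..<n + 1] @ Y @ X @ replicate (n + 1) Ast"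
    "X = Num \<Omega> # X'" "Y = Num (\<Omega> + 1) # Y'" "n + 1 \<le> \<Omega>"
    using germ germ_string_germ[OF germ'] by (rule F_step)
  \<comment> \<open>The label after \<open>01...n\<close> is \<Omega> + 1, which is at least n + 2,
    so the chain ends there.\<close>
  moreover have "W_index (F \<alpha>) = n"
    using F W_index_eq[of "Num (\<Omega> + 1)" n] by (simp add: \<alpha> del: upt_Suc replicate_Suc rev_append)
  moreover have "n < k" using len \<alpha> by simp
  ultimately show ?thesis
    using that[of "rev g" a n X Y \<Omega> X' Y'] parent \<alpha> by (simp del: upt_Suc)
qed

text \<open>Both stopping tests detect the zero germ: any other germ has a chain index below
  k.\<close>

lemma sum_list_0_iff_initial:
  assumes "1 < k" "is_germ k \<alpha>"
  shows "W_index (F \<alpha>) = k \<longleftrightarrow> sum_list \<alpha> = 0" "F \<alpha> = initial_string k \<longleftrightarrow> sum_list \<alpha> = 0"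
proof -
  have "F \<alpha> = initial_string k" if "sum_list \<alpha> = 0"
    using F_zeros[of "rev \<alpha>"] that assms by (simp add: is_germ_def)
  moreover have "sum_list \<alpha> = 0" if "W_index (F \<alpha>) = k"
    using that assms by (metis less_irrefl nonzero_germ_cases)
  ultimately show "W_index (F \<alpha>) = k \<longleftrightarrow> sum_list \<alpha> = 0" "F \<alpha> = initial_string k \<longleftrightarrow> sum_list \<alpha> = 0"
    using W_index_initial_string[of k] assms(1) by auto
qed

section \<open>The Uncastling Procedure\<close>

text \<open>As for castling, the prescribed lengths and the single occurrence of \<omega> determine
  the blocks; \<open>delta_inject\<close> then passes from the new string to the new class.\<close>

lemma uncastling_step_unique:
  assumes "1 < k" "distinct (nums (delta v))"
    and "uncastling_step k (v, \<gamma>) p" "uncastling_step k (v, \<gamma>) p'"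
  shows "p = p'"
proof -
  obtain v1 \<gamma>1 v2 \<gamma>2 where p: "p = (v1, \<gamma>1)" "p' = (v2, \<gamma>2)" by (cases p; cases p')
  define i where "i = W_index (delta v)"
  define W where "W = map Num [0..<i + 1]"
  obtain X Y Z \<omega> X' Y' where 1: "delta v = W @ X @ Y @ Z" "length Z = i + 1"
    "X = Num (\<omega> + 1) # X'" "Y = Num \<omega> # Y'" "v1 \<in> L_mod_pi k"
    "delta v1 = from_zero (W @ Y @ X @ Z)" "\<gamma>1 = set_entry \<gamma> (i + 1) (entry \<gamma> (i + 1) + 1)"
    using assms(3) unfolding p uncastling_step_def prod.case i_def W_def by blast
  obtain X2 Y2 Z2 \<omega>2 X2' Y2' where 2: "delta v = W @ X2 @ Y2 @ Z2" "length Z2 = i + 1"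
    "X2 = Num (\<omega>2 + 1) # X2'" "Y2 = Num \<omega>2 # Y2'" "v2 \<in> L_mod_pi k"
    "delta v2 = from_zero (W @ Y2 @ X2 @ Z2)" "\<gamma>2 = set_entry \<gamma> (i + 1) (entry \<gamma> (i + 1) + 1)"
    using assms(4) unfolding p uncastling_step_def prod.case i_def W_def by blast
  have "(X @ Y) @ Z = (X2 @ Y2) @ Z2" using 1(1) 2(1) by simp
  then have XY: "X @ Y = X2 @ Y2" "Z = Z2"
    using 1(2) 2(2) append_eq_append_conv[of "X @ Y" "X2 @ Y2" Z Z2] by metis+
  then have "\<omega> = \<omega>2" using 1(3) 2(3) by simp
  then have "X @ Num \<omega> # Y' = X2 @ Num \<omega> # Y2'" using XY(1) 1(4) 2(4) by simp
  moreover have "distinct (nums (X @ Num \<omega> # Y'))" using assms(2) 1(1,4) by auto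
  ultimately have "X = X2 \<and> Y' = Y2'" by (rule split_at_Num_unique)
  then have "delta v1 = delta v2" using 1(4,6) 2(4,6) \<open>\<omega> = \<omega>2\<close> XY(2) by simp
  then have "v1 = v2" using delta_inject assms(1) 1(5) 2(5) by blast
  then show ?thesis using p 1(7) 2(7) by simp
qed

text \<open>The step undoes the castling that led from the parent to \<beta>. Lowering an entry of
  \<beta> by 1 raises the same entry of the difference by 1.\<close>

lemma uncastling_step_germ:
  assumes k: "1 < k" and germ: "is_germ k \<beta>" and "sum_list \<beta> \<noteq> 0"
    and len: "length \<alpha> = length \<beta>" and le: "\<And>q. q < length \<beta> \<Longrightarrow> \<beta> ! q \<le> \<alpha> ! q"
  shows "uncastling_step k (germ_class \<beta>, map2 (-) \<alpha> \<beta>)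
    (germ_class (germ_parent \<beta>), map2 (-) \<alpha> (germ_parent \<beta>))"
proof -
  obtain n a \<gamma> \<Omega> X Y X' Y' where \<beta>: "\<beta> = \<gamma> @ Suc a # replicate n 0"
    and parent: "germ_parent \<beta> = \<gamma> @ a # replicate n 0" "is_germ k (germ_parent \<beta>)"
    and n: "W_index (F \<beta>) = n"
    and F: "F (germ_parent \<beta>) = map Num [0..<n + 1] @ X @ Y @ replicate (n + 1) Ast"
      "F \<beta> = map Num [0..<n + 1] @ Y @ X @ replicate (n + 1) Ast"
    and XY: "X = Num \<Omega> # X'" "Y = Num (\<Omega> + 1) # Y'" "n + 1 \<le> \<Omega>"
    using nonzero_germ_cases[OF assms(1-3)] by metis
  let ?q = "length \<gamma>"
  have q: "length \<beta> - (n + 1) = ?q" by (simp add: \<beta>)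
  \<comment> \<open>This makes the truncated subtraction exact at the changed entry.\<close>
  have "Suc a \<le> \<alpha> ! ?q" using le[of ?q] by (simp add: \<beta> nth_append)
  then have string: "map2 (-) \<alpha> (germ_parent \<beta>) =
      set_entry (map2 (-) \<alpha> \<beta>) (n + 1) (entry (map2 (-) \<alpha> \<beta>) (n + 1) + 1)"
    using len q unfolding parent(1) set_entry_def entry_def
    by (intro nth_equalityI) (auto simp: \<beta> nth_append nth_list_update nth_Cons split: nat.split)
  have len': "n + 1 \<le> length (map2 (-) \<alpha> \<beta>)" using len by (simp add: \<beta>)
  have member: "germ_class (germ_parent \<beta>) \<in> L_mod_pi k"
    using germ_class_in_L_mod_pi k parent(2) .
  have delta': "delta (germ_class (germ_parent \<beta>)) =
      from_zero (map Num [0..<n + 1] @ X @ Y @ replicate (n + 1) Ast)"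
    using delta_germ_class[OF k parent(2)] from_zero_F[OF k parent(2)] F(1) by simp
  have delta: "delta (germ_class \<beta>) = F \<beta>" using delta_germ_class[OF k germ] .
  show ?thesis
    unfolding uncastling_step_def prod.case
    \<comment> \<open>The blocks change roles: \<open>Y\<close>, which starts at \<Omega> + 1, is
      the first block of the step, and \<open>X\<close> the second.\<close>
    by (rule exI[of _ n], rule exI[of _ "n + 1"], rule exI[of _ "map Num [0..<n + 1]"],
        rule exI[of _ Y], rule exI[of _ X], rule exI[of _ "replicate (n + 1) Ast"],
        rule exI[of _ \<Omega>], rule exI[of _ Y'], rule exI[of _ X'])
      (use n F(2) XY string len' member delta' delta in \<open>simp del: upt_Suc replicate_Suc\<close>)
qed

text \<open>The class visited at time \<open>m\<close> is that of the \<open>m\<close>-th ancestor of the germ \<open>\<alpha>\<close>, and the string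
  computed so far is the difference of \<open>\<alpha>\<close> and that ancestor.\<close>

lemma uncastling_yields_germ:
  assumes k: "1 < k" and germ: "is_germ k \<alpha>"
  shows "uncastling_yields k (germ_class \<alpha>) \<alpha>"
proof -
  define anc where "anc m = (germ_parent ^^ m) \<alpha>" for m
  define st where "st m = (germ_class (anc m), map2 (-) \<alpha> (anc m))" for m
  \<comment> \<open>Each step lowers the entry sum of the ancestor by 1, so the zero germ is reached
    after \<open>M\<close> steps.\<close>
  define M where "M = sum_list \<alpha>"
  have anc: "is_germ k (anc m) \<and> length (anc m) = length \<alpha> \<and> sum_list (anc m) + m = M \<and>
      (\<forall>q<length \<alpha>. anc m ! q \<le> \<alpha> ! q)" if "m \<le> M" for m
    using that
  proof (induction m)
    case 0
    then show ?case using germ by (simp add: anc_def M_def)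
  next
    case (Suc m)
    then have IH: "is_germ k (anc m)" "length (anc m) = length \<alpha>" "sum_list (anc m) + m = M"
        "\<And>q. q < length \<alpha> \<Longrightarrow> anc m ! q \<le> \<alpha> ! q"
      by auto
    have Suc_anc: "anc (Suc m) = germ_parent (anc m)" by (simp add: anc_def)
    have "sum_list (anc m) \<noteq> 0" using IH(3) Suc.prems by linarith
    then obtain n a \<beta> where \<beta>: "anc m = \<beta> @ Suc a # replicate n 0"
        "anc (Suc m) = \<beta> @ a # replicate n 0" "is_germ k (anc (Suc m))"
      using nonzero_germ_cases[OF k IH(1)] unfolding Suc_anc by metis
    have "anc (Suc m) ! q \<le> anc m ! q" if "q < length \<alpha>" for q
      unfolding \<beta> by (simp add: nth_append nth_Cons split: nat.split)
    then show ?case using \<beta> IH by (auto simp: \<beta>(1,2) intro: order_trans)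
  qed
  have step: "uncastling_step k (st m) (st (Suc m))" if "m < M" for m
  proof -
    have "sum_list (anc m) \<noteq> 0" using anc[of m] that by linarith
    then have "uncastling_step k (germ_class (anc m), map2 (-) \<alpha> (anc m))
        (germ_class (germ_parent (anc m)), map2 (-) \<alpha> (germ_parent (anc m)))"
      using anc[of m] that by (intro uncastling_step_germ[OF k]) auto
    then show ?thesis by (simp add: st_def anc_def)
  qed
  have delta: "delta (fst (st m)) = F (anc m)" if "m \<le> M" for m
    using delta_germ_class[OF k] anc that by (simp add: st_def)
  have unique: "p = st (Suc m)" if "m < M" "uncastling_step k (st m) p" for m p
  proof -
    have "distinct (nums (delta (fst (st m))))"
      using delta[of m] germ_string_is_germ(1)[OF k] anc[of m] that(1) by (simp add: lexical_def)
    then show ?thesis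
      using uncastling_step_unique[OF k, of "fst (st m)" "snd (st m)"] step that by simp
  qed
  \<comment> \<open>For m = 0 the test on \<open>W_index\<close> applies, later the comparison of
    strings; either holds iff the entry sum of \<open>anc m\<close> is 0.\<close>
  have stop: "stopped k (map st [0..<m + 1]) \<longleftrightarrow> m = M" if "m \<le> M" for m
    using sum_list_0_iff_initial[OF k, of "anc m"] anc[OF that] delta[OF that] that
    by (auto simp: stopped_def from_zero_initial_string)
  have "map2 (-) \<alpha> \<alpha> = replicate (k - 1) 0"
    using germ by (intro nth_equalityI) (auto simp: is_germ_def)
  then have st0: "st 0 = (germ_class \<alpha>, replicate (k - 1) 0)" by (simp add: st_def anc_def)
  have run: "uncastling_run k (germ_class \<alpha>) (map st [0..<m + 1])" if "m \<le> M" for m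
    using that
  proof (induction m)
    case 0
    show ?case using uncastling_run.start[of k "germ_class \<alpha>"] st0 by simp
  next
    case (Suc m)
    then have "uncastling_run k (germ_class \<alpha>) (map st [0..<m + 1] @ [st (Suc m)])"
      using stop[of m] step[of m] by (intro uncastling_run.step) auto
    then show ?case by simp
  qed
  \<comment> \<open>A run shorter than the full one can only be continued by
    \<open>st (Suc m)\<close>, and the full one has stopped.\<close>
  have runs: "\<exists>m\<le>M. r = map st [0..<m + 1]" if "uncastling_run k (germ_class \<alpha>) r" for r
    using that
  proof induction
    case start
    then show ?case using st0 by (intro exI[of _ 0]) simp
  next
    case (step r p)
    then obtain m where m: "m \<le> M" "r = map st [0..<m + 1]" by blast
    then have "m < M" using step stop[of m] by auto
    then have "p = st (Suc m)" using unique step m by simp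
    then have "r @ [p] = map st [0..<Suc m + 1]" using m by simp
    then show ?case using \<open>m < M\<close> by (intro exI[of _ "Suc m"]) (simp del: upt_Suc)
  qed
  \<comment> \<open>The last ancestor is the zero germ, so the difference is \<alpha>
    itself.\<close>
  have "map2 (-) \<alpha> (anc M) = \<alpha>"
  proof (rule nth_equalityI)
    fix q assume "q < length (map2 (-) \<alpha> (anc M))"
    moreover have "\<forall>x\<in>set (anc M). x = 0" using anc[of M] by simp
    ultimately have "anc M ! q = 0" "q < length (map2 (-) \<alpha> (anc M))" by auto
    then show "map2 (-) \<alpha> (anc M) ! q = \<alpha> ! q" by simp
  qed (use anc[of M] in simp)
  then have "snd (last (map st [0..<M + 1])) = \<alpha>" by (simp add: st_def)
  moreover have "prefix r (map st [0..<M + 1])" if r: "uncastling_run k (germ_class \<alpha>) r" for r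
  proof -
    obtain m where m: "m \<le> M" "r = map st [0..<m + 1]" using runs[OF r] by blast
    then have "[0..<M + 1] = [0..<m + 1] @ [m + 1..<M + 1]"
      using upt_add_eq_append[of 0 "m + 1" "M - m"] by simp
    then show ?thesis using m by (simp del: upt_Suc)
  qed
  ultimately show ?thesis
    unfolding uncastling_yields_def using run[of M] stop[of M] by blast
qed

text \<open>Each of the two stopped runs is a prefix of the other.\<close>

lemma uncastling_yields_unique:
  assumes "uncastling_yields k v \<alpha>" "uncastling_yields k v \<alpha>'"
  shows "\<alpha> = \<alpha>'"
  using assms unfolding uncastling_yields_def by (metis prefix_order.antisym)

theorem theorem7:
  fixes k :: nat and v :: "bool list set"
  assumes "1 < k" and "v \<in> L_mod_pi k"
  shows "\<exists>\<alpha>. is_germ k \<alpha> \<and> from_zero (F \<alpha>) = delta v \<and>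
           (\<forall>\<alpha>'. is_germ k \<alpha>' \<and> from_zero (F \<alpha>') = delta v \<longrightarrow> \<alpha>' = \<alpha>) \<and>
           uncastling_yields k v \<alpha>"
proof -
  obtain \<alpha> where \<alpha>: "is_germ k \<alpha>" "v = germ_class \<alpha>" using assms by (rule exists_germ_class)
  \<comment> \<open>A second germ with this string has the same class, from which the procedure
    returns both germs.\<close>
  have "\<alpha>' = \<alpha>" if \<alpha>': "is_germ k \<alpha>'" "from_zero (F \<alpha>') = delta v" for \<alpha>'
  proof -
    have "delta (germ_class \<alpha>') = delta v"
      using \<alpha>' delta_germ_class from_zero_F assms(1) by simp
    then have "germ_class \<alpha>' = v"
      using delta_inject germ_class_in_L_mod_pi assms \<alpha>'(1) by blast
    then show ?thesis
      using uncastling_yields_unique[of k v \<alpha>' \<alpha>] uncastling_yields_germ[OF assms(1)] \<alpha> \<alpha>'(1)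
      by metis
  qed
  moreover have "from_zero (F \<alpha>) = delta v"
    using \<alpha> delta_germ_class from_zero_F assms(1) by simp
  ultimately show ?thesis using \<alpha> uncastling_yields_germ assms(1) by blast
qed

end
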